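(* Let $d\ge2$ and let $\mathbf{k}\in C^1(\mathbb{R}^d,\mathbb{R}^{d\times d})\cap L^1(\mathbb{R}^d,\mathbb{R}^{d\times d})$ be a TRI kernel whose Fourier transform $\widehat{\mathbf{k}}$ is also in $L^1(\mathbb{R}^d,\mathbb{R}^{d\times d})$. Write $\widehat{\mathbf{k}}(\xi)=h^\parallel(\|\xi\|)\,\mathrm{Pr}_\xi^\parallel+h^\perp(\|\xi\|)\,\mathrm{Pr}_\xi^\perp$ for $\xi\ne0$. Then the vector field $x\mapsto\mathbf{k}(x)\alpha$ is divergence-free for all $\alpha\in\mathbb{R}^d$ if and only if $h^\parallel=0$. On the other hand, $x\mapsto\mathbf{k}(x)\alpha$ is curl-free for all $\alpha\in\mathbb{R}^d$ if and only if $h^\perp=0$.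
   Context: For $x\in\mathbb{R}^d\setminus\{0\}$, $\mathrm{Pr}_x^\parallel:=xx^T/\|x\|^2$ and $\mathrm{Pr}_x^\perp:=\mathbb{I}_d-xx^T/\|x\|^2$. A TRI (translation- and rotation-invariant) kernel is a function $\mathbf{k}:\mathbb{R}^d\to\mathbb{R}^{d\times d}$ such that: $\sum_{a,b=1}^N\alpha_a\cdot\mathbf{k}(x_a-x_b)\alpha_b\ge0$ for all $N$ and all $x_a,\alpha_a\in\mathbb{R}^d$; $\mathbf{k}(-x)=\mathbf{k}(x)^T$; and $\mathbf{k}(Rx)=R\mathbf{k}(x)R^{-1}$ for all $R\in O(\mathbb{R}^d)$. Equivalently to the last two conditions, $\mathbf{k}(0)=k_0\mathbb{I}_d$ and $\mathbf{k}(x)=k^\parallel(\|x\|)\mathrm{Pr}_x^\parallel+k^\perp(\|x\|)\mathrm{Pr}_x^\perp$ for $x\neq0$, for some $k_0\in\mathbb{R}$ and $k^\parallel,k^\perp:(0,\infty)\to\mathbb{R}$. The Fourier transform is entrywise, $\widehat f(\xi)=\int f(x)e^{-2\pi i x\cdot\xi}dx$; for such integrable $\mathbf{k}$ it has the displayed form with unique functions $h^\parallel,h^\perp:(0,\infty)\to\mathbb{R}$. The curl of a vector field $v=(v_1,\dots,v_d)$ is the exterior derivative of the 1-form $\sum_i v_i\,dx^i$, so curl-free means $\partial_iv_j=\partial_jv_i$ for all $i,j$. *)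

theory Defs
  imports "HOL-Analysis.Analysis"
begin

definition C1_on_UNIV ::
  "('a::real_normed_vector \<Rightarrow> 'b::real_normed_vector) \<Rightarrow> bool" where
  "C1_on_UNIV f \<longleftrightarrow>
    (\<exists>f' :: 'a \<Rightarrow> 'a \<Rightarrow>\<^sub>L 'b.
      (\<forall>x. (f has_derivative blinfun_apply (f' x)) (at x)) \<and> continuous_on UNIV f')"

definition proj_par :: "real^'d \<Rightarrow> real^'d^'d" where
  "proj_par x = (1 / (norm x)\<^sup>2) *\<^sub>R (\<chi> i j. x $ i * x $ j)"

definition proj_perp :: "real^'d \<Rightarrow> real^'d^'d" where
  "proj_perp x = mat 1 - proj_par x"

definition TRI_kernel :: "(real^'d \<Rightarrow> real^'d^'d) \<Rightarrow> bool" where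
  "TRI_kernel k \<longleftrightarrow>
    (\<forall>(N::nat) (x :: nat \<Rightarrow> real^'d) (\<alpha> :: nat \<Rightarrow> real^'d).
       0 \<le> (\<Sum>a<N. \<Sum>b<N. \<alpha> a \<bullet> (k (x a - x b) *v \<alpha> b))) \<and>
    (\<forall>x. k (- x) = transpose (k x)) \<and>
    (\<forall>R x. orthogonal_matrix R \<longrightarrow> k (R *v x) = R ** k x ** matrix_inv R)"

definition fourier_matrix :: "(real^'d \<Rightarrow> real^'d^'d) \<Rightarrow> real^'d \<Rightarrow> complex^'d^'d" where
  "fourier_matrix k \<xi> =
    (\<chi> i j. LINT x|lborel.
       exp (- (2 * of_real pi * \<i> * of_real (x \<bullet> \<xi>))) * of_real (k x $ i $ j))"

definition partial_deriv :: "'d \<Rightarrow> (real^'d \<Rightarrow> real) \<Rightarrow> real^'d \<Rightarrow> real" where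
  "partial_deriv i f x = deriv (\<lambda>t. f (x + t *\<^sub>R axis i 1)) 0"

definition divergence :: "(real^'d \<Rightarrow> real^'d) \<Rightarrow> real^'d \<Rightarrow> real" where
  "divergence v x = (\<Sum>i\<in>UNIV. partial_deriv i (\<lambda>y. v y $ i) x)"

definition divergence_free :: "(real^'d \<Rightarrow> real^'d) \<Rightarrow> bool" where
  "divergence_free v \<longleftrightarrow> (\<forall>x. divergence v x = 0)"

text \<open>The curl is the exterior derivative of the 1-form with coefficients \<open>v\<close>; it is
  represented by its antisymmetric matrix of components, in any dimension.\<close>

definition curl :: "(real^'d \<Rightarrow> real^'d) \<Rightarrow> real^'d \<Rightarrow> real^'d^'d" where
  "curl v x =
    (\<chi> i j. partial_deriv i (\<lambda>y. v y $ j) x - partial_deriv j (\<lambda>y. v y $ i) x)"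

definition curl_free :: "(real^'d \<Rightarrow> real^'d) \<Rightarrow> bool" where
  "curl_free v \<longleftrightarrow> (\<forall>x. curl v x = 0)"

end

theory Submission
  imports Defs "HOL-Probability.Characteristic_Functions"
begin

text \<open>
  Divergence and curl components of \<open>x \<mapsto> k x *v \<alpha>\<close> are divergences of integrable vector fields
  \<open>w = T \<circ> k\<close> with \<open>T\<close> linear, so both equivalences follow from one statement: \<open>div w = 0\<close> iff the
  Fourier transform of \<open>w\<close> is pointwise orthogonal to the frequency. As \<open>div w\<close> need not be integrable,
  both directions integrate by parts against compactly supported \<open>C\<^sup>1\<close> functions. If \<open>div w = 0\<close>, take
  the test functions \<open>\<chi> (t x) e\<^bsub>-\<xi>\<^esub>(x)\<close>, where \<open>\<chi>\<close> is a bump function and \<open>e\<^bsub>-\<xi>\<^esub>\<close> a character, and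
  let \<open>t \<rightarrow> 0\<close>. Conversely, Fourier inversion (\<open>w\<close> is bounded because \<open>k\<close> is positive definite) and
  Fubini turn \<open>\<integral> w \<bullet> \<nabla>\<phi>\<close> into an integral containing the factor \<open>\<xi> \<bullet> w^(\<xi>) = 0\<close>, hence \<open>\<integral> \<phi> div w = 0\<close>
  for every bump function \<open>\<phi>\<close>.
\<close>

subsection \<open>Integration by parts\<close>

lemma integral_lborel_affine:
  fixes f :: "'a::euclidean_space \<Rightarrow> 'b::{banach, second_countable_topology}"
  assumes [measurable]: "f \<in> borel_measurable borel" and "t \<noteq> 0"
  shows "(LINT x|lborel. f x) = \<bar>t\<bar> ^ DIM('a) *\<^sub>R (LINT x|lborel. f (a + t *\<^sub>R x))"
  by (subst lborel_affine[OF \<open>t \<noteq> 0\<close>, of a]) (simp add: integral_density integral_distr)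

lemma integrable_lborel_affine:
  fixes f :: "'a::euclidean_space \<Rightarrow> 'b::{banach, second_countable_topology}"
  assumes "integrable lborel f" and "t \<noteq> 0"
  shows "integrable lborel (\<lambda>x. f (a + t *\<^sub>R x))"
proof -
  have [measurable]: "f \<in> borel_measurable borel"
    using assms(1) by (auto dest: borel_measurable_integrable)
  have "integrable lborel (\<lambda>x. \<bar>t\<bar> ^ DIM('a) *\<^sub>R f (a + t *\<^sub>R x))"
    using assms by (subst (asm) lborel_affine[OF \<open>t \<noteq> 0\<close>, of a])
      (simp add: integrable_density integrable_distr_eq)
  from integrable_scaleR_right[OF this, of "inverse (\<bar>t\<bar> ^ DIM('a))"] show ?thesis
    using assms(2) by simp
qed

lemma integrable_lborel_translate:
  fixes f :: "'a::euclidean_space \<Rightarrow> 'b::{banach, second_countable_topology}"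
  assumes "integrable lborel f"
  shows "integrable lborel (\<lambda>x. f (a + x))"
  using integrable_lborel_affine[OF assms, of 1 a] by simp

lemma integral_lborel_translate:
  fixes f :: "'a::euclidean_space \<Rightarrow> 'b::{banach, second_countable_topology}"
  assumes "integrable lborel f"
  shows "(LINT x|lborel. f (a + x)) = (LINT x|lborel. f x)"
  using integral_lborel_affine[of f 1 a] assms by simp

lemma integrable_compact_support:
  fixes g :: "'a::euclidean_space \<Rightarrow> 'b::{banach, second_countable_topology}"
  assumes "continuous_on UNIV g" and "\<And>x. R < norm x \<Longrightarrow> g x = 0"
  shows "integrable lborel g"
proof -
  have "integrable lborel (\<lambda>x. indicator (cball 0 R) x *\<^sub>R g x)"
    by (rule borel_integrable_compact) (use assms in \<open>auto intro: continuous_on_subset\<close>)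
  moreover have "(\<lambda>x. indicator (cball 0 R) x *\<^sub>R g x) = g"
    using assms(2) by (fastforce simp: indicator_def)
  ultimately show ?thesis by simp
qed

text \<open>Continuity is asked one direction at a time. In finite dimension this matches continuity
  in operator norm, and derivatives stay plain functions to which the product and chain rules apply
  directly.\<close>

definition has_C1_derivative :: "('a::euclidean_space \<Rightarrow> 'b::real_normed_vector) \<Rightarrow> ('a \<Rightarrow> 'a \<Rightarrow> 'b) \<Rightarrow> bool" where
  "has_C1_derivative f D \<longleftrightarrow>
    (\<forall>x. (f has_derivative D x) (at x)) \<and> (\<forall>b. continuous_on UNIV (\<lambda>x. D x b))"

lemma has_C1_derivativeD:
  assumes "has_C1_derivative f D"
  shows "(f has_derivative D x) (at x)" "continuous_on UNIV (\<lambda>x. D x b)" "continuous_on UNIV f" "linear (D x)"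
  using assms unfolding has_C1_derivative_def
  by (auto intro: has_derivative_linear)
     (meson has_derivative_continuous continuous_at_imp_continuous_on)

text \<open>By translation invariance the difference quotients integrate to \<open>0\<close>; dominated convergence does the rest.\<close>

lemma integral_derivative_compact_support:
  fixes g :: "'a::euclidean_space \<Rightarrow> 'b::{banach, second_countable_topology}"
  assumes C1: "has_C1_derivative g D"
    and supp: "\<And>x. R < norm x \<Longrightarrow> g x = 0"
  shows "(LINT x|lborel. D x b) = 0"
proof -
  define t where "t n = 1 / real (Suc n)" for n
  \<comment> \<open>The difference quotients below shift by at most \<open>b\<close>, so all of them
    vanish outside the ball of radius \<open>S\<close>.\<close>
  define S where "S = R + norm b"
  have t: "0 < t n" "t n \<le> 1" for n by (auto simp: t_def)
  have t0: "t \<longlonglongrightarrow> 0" unfolding t_def by (rule LIMSEQ_Suc[OF lim_const_over_n])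
  note deriv = has_C1_derivativeD(1)[OF C1] and cont = has_C1_derivativeD(2)[OF C1, of b]
    and gcont = has_C1_derivativeD(3)[OF C1] and lin = has_C1_derivativeD(4)[OF C1]
  have gi: "integrable lborel g" by (rule integrable_compact_support[OF gcont supp])
  define q where "q n x = (1 / t n) *\<^sub>R (g (t n *\<^sub>R b + x) - g x)" for n x
  \<comment> \<open>For \<open>x\<close> within radius \<open>S\<close> every shifted segment stays
    within radius \<open>S + norm b\<close>, so the bound \<open>M\<close> on this larger ball
    serves all quotients at once.\<close>
  have "compact ((\<lambda>x. D x b) ` cball 0 (S + norm b))"
    by (rule compact_continuous_image) (auto intro: continuous_on_subset[OF cont])
  then obtain M where M: "\<And>x. norm x \<le> S + norm b \<Longrightarrow> norm (D x b) \<le> M"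
    by (fastforce dest: compact_imp_bounded simp: bounded_iff)
  have q0: "q n x = 0" if "S < norm x" for n x
  proof -
    have "norm x - norm (t n *\<^sub>R b) \<le> norm (t n *\<^sub>R b + x)"
      by (metis add.commute norm_diff_ineq)
    moreover have "norm (t n *\<^sub>R b) \<le> norm b" using t[of n] by (simp add: mult_left_le_one_le)
    moreover have "R < norm x" using that unfolding S_def by (smt (verit) norm_ge_zero)
    ultimately show ?thesis using that by (simp add: q_def supp S_def)
  qed
  have qM: "norm (q n x) \<le> M" if "norm x \<le> S" for n x
  proof -
    have vd: "((\<lambda>s. g (s *\<^sub>R b + x)) has_derivative (\<lambda>h. D (s *\<^sub>R b + x) (h *\<^sub>R b))) (at s within {0..t n})" for s
      by (rule has_derivative_compose[OF _ deriv, where f = "\<lambda>s. s *\<^sub>R b + x"])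
         (auto intro!: derivative_eq_intros)
    have "norm (g (t n *\<^sub>R b + x) - g (0 *\<^sub>R b + x)) \<le> M * norm (t n - 0)"
    proof (rule differentiable_bound[OF _ vd])
      fix s assume s: "s \<in> {0..t n}"
      have "norm (s *\<^sub>R b + x) \<le> \<bar>s\<bar> * norm b + norm x"
        by (metis norm_scaleR norm_triangle_ineq)
      also have "\<bar>s\<bar> * norm b \<le> norm b" using s t(2)[of n] by (simp add: mult_left_le_one_le)
      finally have "norm (D (s *\<^sub>R b + x) b) \<le> M" using that by (intro M) linarith
      then show "onorm (\<lambda>h. D (s *\<^sub>R b + x) (h *\<^sub>R b)) \<le> M"
        by (intro onorm_le) (auto simp: linear_cmul[OF lin] mult.commute[of M] intro: mult_left_mono)
    qed (use t(1)[of n] in auto)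
    then show ?thesis using t(1)[of n] by (simp add: q_def pos_divide_le_eq add.commute)
  qed
  have lim: "(\<lambda>n. q n x) \<longlonglongrightarrow> D x b" for x
  proof -
    have "((\<lambda>s. g (s *\<^sub>R b + x)) has_derivative (\<lambda>h. D (0 *\<^sub>R b + x) (h *\<^sub>R b))) (at 0)"
      by (rule has_derivative_compose[OF _ deriv, where f = "\<lambda>s. s *\<^sub>R b + x"])
         (auto intro!: derivative_eq_intros)
    then have "((\<lambda>h. norm (g (h *\<^sub>R b + x) - g x - h *\<^sub>R D x b) / norm h) \<longlongrightarrow> 0) (at 0)"
      by (simp add: has_derivative_at linear_cmul[OF lin])
    then have "((\<lambda>n. norm (g (t n *\<^sub>R b + x) - g x - t n *\<^sub>R D x b) / norm (t n)) \<longlonglongrightarrow> 0)"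
      by (rule filterlim_compose) (use t t0 in \<open>auto simp: filterlim_at less_le\<close>)
    moreover have "norm (g (t n *\<^sub>R b + x) - g x - t n *\<^sub>R D x b) / norm (t n) = norm (q n x - D x b)" for n
    proof -
      have "g (t n *\<^sub>R b + x) - g x - t n *\<^sub>R D x b = t n *\<^sub>R (q n x - D x b)"
        using t(1)[of n] by (simp add: q_def scaleR_diff_right)
      then show ?thesis using t(1)[of n] by simp
    qed
    ultimately show ?thesis
      by (simp add: tendsto_norm_zero_iff LIM_zero_iff)
  qed
  have qi: "(LINT x|lborel. q n x) = 0" for n
    using integral_lborel_translate[OF gi, of "t n *\<^sub>R b"] integrable_lborel_translate[OF gi, of "t n *\<^sub>R b"] gi
    by (simp add: q_def)
  have "(\<lambda>n. LINT x|lborel. q n x) \<longlonglongrightarrow> (LINT x|lborel. D x b)"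
  proof (rule integral_dominated_convergence)
    show "integrable lborel (\<lambda>x::'a. indicator (cball 0 S) x *\<^sub>R M)"
      by (rule borel_integrable_compact) auto
    show "AE x in lborel. norm (q n x) \<le> indicator (cball 0 S) x *\<^sub>R M" for n
      using qM q0 by (auto simp: indicator_def not_le)
    show "(\<lambda>x. D x b) \<in> borel_measurable lborel"
      using borel_measurable_continuous_onI[OF cont] by simp
    show "q n \<in> borel_measurable lborel" for n
      unfolding q_def using borel_measurable_continuous_onI[OF gcont] by measurable
  qed (use lim in auto)
  then show ?thesis unfolding qi by (simp add: LIMSEQ_const_iff)
qed

subsection \<open>Gaussian integrals\<close>

text \<open>With this normalisation the integral is one and the function is its own Fourier
  transform in the convention with 2 pi in the exponent.\<close>

definition gauss :: "'a::euclidean_space \<Rightarrow> real" where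
  "gauss x = exp (- pi * (norm x)\<^sup>2)"

lemma gauss_eq_prod: "gauss x = (\<Prod>b\<in>Basis. exp (- pi * (x \<bullet> b)\<^sup>2))"
proof -
  have "(norm x)\<^sup>2 = (\<Sum>b\<in>Basis. (x \<bullet> b)\<^sup>2)"
    unfolding power2_norm_eq_inner by (subst euclidean_inner) (simp add: power2_eq_square)
  then show ?thesis
    by (simp add: gauss_def exp_sum sum_distrib_left)
qed

lemma continuous_gauss [continuous_intros]:
  "continuous_on S f \<Longrightarrow> continuous_on S (\<lambda>x. gauss (f x))"
  unfolding gauss_def by (intro continuous_intros)

lemma borel_measurable_gauss [measurable]: "gauss \<in> borel_measurable borel"
  by (intro borel_measurable_continuous_onI continuous_intros)

lemma
  shows integrable_gauss_cis_real: "integrable lborel (\<lambda>z::real. exp (- pi * z\<^sup>2) *\<^sub>R cis (a * z))" (is ?I)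
    and integral_gauss_cis_real: "(LINT z|lborel. exp (- pi * z\<^sup>2) *\<^sub>R cis (a * z)) =
      complex_of_real (exp (- a\<^sup>2 / (4 * pi)))" (is ?E)
proof -
  \<comment> \<open>Rescaling by \<open>c\<close> passes from variance one to the exponent
    \<open>- pi * z\<^sup>2\<close>, so the integral becomes the characteristic function of the
    standard normal law at \<open>a / c\<close>.\<close>
  define c where "c = sqrt (2 * pi)"
  have c: "0 < c" "c\<^sup>2 = 2 * pi" by (auto simp: c_def)
  have dens: "c * std_normal_density (c * z) = exp (- pi * z\<^sup>2)" for z
    using c by (simp add: normal_density_def c_def power_mult_distrib)
  have "integrable lborel (\<lambda>z::real. c * std_normal_density (0 + c * z))"
    using c by (intro integrable_mult_right lborel_integrable_real_affine integrable_normal_density) auto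
  then have "integrable lborel (\<lambda>z::real. exp (- pi * z\<^sup>2))"
    by (simp only: add_0 dens)
  then show ?I
    by (rule Bochner_Integration.integrable_bound) (auto simp: cis_conv_exp)
  define f where "f x = std_normal_density x *\<^sub>R iexp (a / c * x)" for x
  have f_meas: "f \<in> borel_measurable borel" unfolding f_def by measurable
  have "complex_of_real (exp (- (a / c)\<^sup>2 / 2)) = char std_normal_distribution (a / c)"
    by (simp add: char_std_normal_distribution)
  also have "\<dots> = (LINT x|lborel. f x)"
    unfolding char_def f_def by (subst integral_density) auto
  also have "\<dots> = c *\<^sub>R (LINT z|lborel. f (0 + c *\<^sub>R z))"
    using c by (subst integral_lborel_affine[of f c 0]) (auto simp: f_meas)
  also have "\<dots> = (LINT z|lborel. c *\<^sub>R f (c * z))" by simp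
  also have "(\<lambda>z. c *\<^sub>R f (c * z)) = (\<lambda>z. exp (- pi * z\<^sup>2) *\<^sub>R cis (a * z))"
  proof
    fix z
    have "c *\<^sub>R f (c * z) = (c * std_normal_density (c * z)) *\<^sub>R iexp (a * z)"
      using c by (simp add: f_def)
    then show "c *\<^sub>R f (c * z) = exp (- pi * z\<^sup>2) *\<^sub>R cis (a * z)"
      by (simp only: dens cis_conv_exp)
  qed
  finally show ?E using c by (simp add: power_divide)
qed

text \<open>Gaussian and character both factor over the coordinates, and \<open>lborel\<close> is
  the image of a product of real Lebesgue measures, so the one-dimensional integrals
  multiply.\<close>

lemma
  fixes y :: "'a::euclidean_space"
  shows integrable_gauss_cis: "integrable lborel (\<lambda>x. gauss x *\<^sub>R cis (s * (x \<bullet> y)))" (is ?I)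
    and integral_gauss_cis: "(LINT x|lborel. gauss x *\<^sub>R cis (s * (x \<bullet> y))) =
      complex_of_real (exp (- (s * norm y)\<^sup>2 / (4 * pi)))" (is ?E)
proof -
  interpret product_sigma_finite "\<lambda>_::'a. lborel :: real measure" ..
  define f where "f b z = exp (- pi * z\<^sup>2) *\<^sub>R cis (s * (y \<bullet> b) * z)" for b :: 'a and z
  define T :: "('a \<Rightarrow> real) \<Rightarrow> 'a" where "T z = (\<Sum>b\<in>Basis. z b *\<^sub>R b)" for z
  have [measurable]: "T \<in> (\<Pi>\<^sub>M b\<in>Basis. lborel) \<rightarrow>\<^sub>M borel" unfolding T_def by measurable
  have fi: "integrable lborel (f b)" for b
    unfolding f_def by (rule integrable_gauss_cis_real)
  have [measurable]: "f b \<in> borel_measurable borel" for b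
    using borel_measurable_integrable[OF fi] by simp
  have fE: "integral\<^sup>L lborel (f b) = exp (- (s * (y \<bullet> b))\<^sup>2 / (4 * pi))" for b
    unfolding f_def by (rule integral_gauss_cis_real)
  have cis_prod: "cis (\<Sum>b\<in>Basis. h b) = (\<Prod>b\<in>Basis. cis (h b))" for h :: "'a \<Rightarrow> real"
    by (simp add: cis_conv_exp exp_sum sum_distrib_left)
  have eq: "gauss x *\<^sub>R cis (s * (x \<bullet> y)) = (\<Prod>b\<in>Basis. f b (x \<bullet> b))" for x
    by (subst euclidean_inner)
       (simp add: gauss_eq_prod f_def scaleR_conv_of_real prod.distrib cis_prod[symmetric]
         sum_distrib_left mult_ac)
  have Tb: "T z \<bullet> b = z b" if "b \<in> Basis" for z b
    using that by (simp add: T_def)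
  have "integrable (\<Pi>\<^sub>M b\<in>Basis. lborel) (\<lambda>z. \<Prod>b\<in>Basis. f b (z b))"
    by (rule product_integrable_prod) (use fi in auto)
  then show ?I
    unfolding lborel_eq[where 'a='a] T_def[symmetric]
    by (subst integrable_distr_eq) (auto simp: eq Tb cong: prod.cong)
  have "(LINT x|lborel. gauss x *\<^sub>R cis (s * (x \<bullet> y))) = integral\<^sup>L (\<Pi>\<^sub>M b\<in>Basis. lborel) (\<lambda>z. \<Prod>b\<in>Basis. f b (z b))"
    unfolding lborel_eq[where 'a='a] T_def[symmetric]
    by (subst integral_distr) (auto simp: eq Tb cong: prod.cong)
  also have "\<dots> = (\<Prod>b\<in>Basis. integral\<^sup>L lborel (f b))"
    by (rule product_integral_prod) (use fi in auto)
  also have "\<dots> = exp (\<Sum>b\<in>Basis. - (s * (y \<bullet> b))\<^sup>2 / (4 * pi))"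
    by (simp add: fE exp_sum)
  also have "(\<Sum>b\<in>Basis. - (s * (y \<bullet> b))\<^sup>2 / (4 * pi)) = - (s * norm y)\<^sup>2 / (4 * pi)"
  proof -
    have "(norm y)\<^sup>2 = (\<Sum>b\<in>Basis. (y \<bullet> b)\<^sup>2)"
      unfolding power2_norm_eq_inner by (subst euclidean_inner) (simp add: power2_eq_square)
    then show ?thesis
      by (simp add: power_mult_distrib sum_negf sum_divide_distrib[symmetric] sum_distrib_left)
  qed
  finally show ?E .
qed

subsection \<open>Fourier inversion\<close>

text \<open>The free scale covers the forward transform (\<open>s = - 2 * pi\<close>) and the
  inverse one (\<open>s = 2 * pi\<close>), so the lemmas below serve both.\<close>

definition fourier_int :: "real \<Rightarrow> ('a::euclidean_space \<Rightarrow> complex) \<Rightarrow> 'a \<Rightarrow> complex" where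
  "fourier_int s f y = (LINT x|lborel. f x * cis (s * (x \<bullet> y)))"

lemma borel_measurable_cis [measurable]:
  "f \<in> borel_measurable M \<Longrightarrow> (\<lambda>x. cis (f x)) \<in> borel_measurable M"
  by (rule measurable_compose[of f M borel]) (auto intro!: borel_measurable_continuous_onI continuous_intros)

lemma borel_measurable_fourier_int [measurable]:
  fixes f :: "'a::euclidean_space \<Rightarrow> complex"
  assumes [measurable]: "f \<in> borel_measurable borel"
  shows "fourier_int s f \<in> borel_measurable borel"
  unfolding fourier_int_def by measurable

lemma integrable_mult_cis:
  assumes "integrable M f" and [measurable]: "g \<in> borel_measurable M"
  shows "integrable M (\<lambda>x. f x * cis (g x))"
  using assms(1) by (rule Bochner_Integration.integrable_bound) (use assms in \<open>auto simp: norm_mult\<close>)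

text \<open>The multiplication formula moves the transform from one factor to the other. The phase
  is symmetric in both variables and has modulus one, so the double integral converges absolutely
  and Fubini applies.\<close>

lemma
  fixes f g :: "'a::euclidean_space \<Rightarrow> complex"
  assumes f: "integrable lborel f" and g: "integrable lborel g"
  shows integrable_mult_fourier_int: "integrable lborel (\<lambda>x. f x * fourier_int s g x)" (is ?I)
    and integral_mult_fourier_int: "(LINT x|lborel. f x * fourier_int s g x) = (LINT x|lborel. g x * fourier_int s f x)" (is ?E)
proof -
  have [measurable]: "f \<in> borel_measurable borel" "g \<in> borel_measurable borel"
    using f g by (auto dest: borel_measurable_integrable)
  define K where "K = (\<lambda>(x, y). f x * g y * cis (s * (y \<bullet> x)))"
  have K: "integrable (lborel \<Otimes>\<^sub>M lborel) K"
  proof (rule lborel_pair.Fubini_integrable)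
    show "K \<in> borel_measurable (lborel \<Otimes>\<^sub>M lborel)" unfolding K_def by measurable
    show "integrable lborel (\<lambda>x. LINT y|lborel. norm (K (x, y)))"
      using f g by (simp add: K_def norm_mult)
    show "AE x in lborel. integrable lborel (\<lambda>y. K (x, y))"
      using g by (auto simp: K_def mult.assoc intro!: integrable_mult_cis integrable_mult_right)
  qed
  have fst: "f x * fourier_int s g x = (LINT y|lborel. K (x, y))" for x
    by (simp add: fourier_int_def K_def mult.assoc)
  have snd: "g y * fourier_int s f y = (LINT x|lborel. K (x, y))" for y
    by (simp add: fourier_int_def K_def inner_commute mult.left_commute[of _ "g y"] mult.assoc)
  show ?I unfolding fst by (rule lborel_pair.integrable_fst'[OF K])
  have "(LINT x|lborel. LINT y|lborel. K (x, y)) = (LINT y|lborel. LINT x|lborel. K (x, y))"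
    using lborel_pair.Fubini_integral[of "\<lambda>x y. K (x, y)"] K by simp
  then show ?E unfolding fst snd .
qed

text \<open>Pairing the transform with \<open>gauss (t x) e\<^sub>a(x)\<close> gives, after rescaling, the average of
  \<open>f (a + t u)\<close> against \<open>gauss u\<close>; then let \<open>t \<rightarrow> 0\<close>.\<close>

theorem fourier_inversion:
  fixes f :: "'a::euclidean_space \<Rightarrow> complex"
  assumes f: "integrable lborel f" and cont: "continuous_on UNIV f"
    and bound: "\<And>x. norm (f x) \<le> B"
    and fhat: "integrable lborel (fourier_int (- 2 * pi) f)"
  shows "fourier_int (2 * pi) (fourier_int (- 2 * pi) f) a = f a"
proof -
  define F where "F = fourier_int (- 2 * pi) f"
  have Fi: "integrable lborel F" using fhat unfolding F_def .
  define t where "t n = 1 / real (Suc n)" for n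
  have t: "0 < t n" for n by (auto simp: t_def)
  have t0: "t \<longlonglongrightarrow> 0" unfolding t_def by (rule LIMSEQ_Suc[OF lim_const_over_n])
  have [measurable]: "f \<in> borel_measurable borel" "F \<in> borel_measurable borel"
    using f Fi by (auto dest: borel_measurable_integrable)
  have gi: "integrable lborel (\<lambda>x::'a. gauss x)"
    using integrable_norm[OF integrable_gauss_cis[of 0 0]] by (simp add: gauss_def)
  have gauss1: "(LINT x|lborel. gauss (x::'a)) = 1"
  proof -
    have "complex_of_real (LINT x|lborel. gauss (x::'a)) = (LINT x|lborel. gauss (x::'a) *\<^sub>R cis (0 * (x \<bullet> 0)))"
      by (simp add: scaleR_conv_of_real)
    then show ?thesis unfolding integral_gauss_cis by simp
  qed
  \<comment> \<open>Gaussian damping makes the character integrable. As \<open>t n\<close> tends to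
    zero the damping disappears, and pairing \<open>F\<close> with \<open>g n\<close> becomes the
    inverse transform at \<open>a\<close>.\<close>
  define g where "g n x = gauss (t n *\<^sub>R x) *\<^sub>R cis (2 * pi * (x \<bullet> a))" for n and x :: 'a
  have gn_int: "integrable lborel (g n)" for n
    using t[of n] integrable_mult_cis[of lborel "\<lambda>x. complex_of_real (gauss (t n *\<^sub>R x))" "\<lambda>x. 2 * pi * (x \<bullet> a)"]
      integrable_lborel_affine[OF gi, of "t n" 0]
    by (simp add: g_def[abs_def] scaleR_conv_of_real)
  \<comment> \<open>Centred at \<open>a\<close> and rescaled by \<open>t n\<close>, the transform
    depends on \<open>n\<close> only through a power of \<open>t n\<close>, which the Jacobian of
    the substitution cancels in \<open>eq\<close>.\<close>
  have ghat: "fourier_int (- 2 * pi) (g n) (a + t n *\<^sub>R u) = (1 / t n ^ DIM('a)) *\<^sub>R gauss u" for n u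
  proof -
    have "g n x * cis (- 2 * pi * (x \<bullet> (a + t n *\<^sub>R u))) =
        gauss (0 + t n *\<^sub>R x) *\<^sub>R cis (- 2 * pi * ((0 + t n *\<^sub>R x) \<bullet> u))" for x
      by (simp add: g_def cis_mult algebra_simps inner_simps)
    then have "t n ^ DIM('a) *\<^sub>R fourier_int (- 2 * pi) (g n) (a + t n *\<^sub>R u) =
        (LINT x|lborel. gauss x *\<^sub>R cis (- 2 * pi * (x \<bullet> u)))"
      unfolding fourier_int_def
      using t[of n] integral_lborel_affine[of "\<lambda>x. gauss x *\<^sub>R cis (- 2 * pi * (x \<bullet> u))" "t n" 0] by simp
    also have "\<dots> = complex_of_real (gauss u)"
      unfolding integral_gauss_cis by (simp add: gauss_def power_mult_distrib power2_eq_square)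
    finally show ?thesis
      using t[of n] by (simp add: scaleR_conv_of_real field_simps)
  qed
  have eq: "(LINT x|lborel. F x * g n x) = (LINT u|lborel. gauss u *\<^sub>R f (a + t n *\<^sub>R u))" for n
  proof -
    have m: "fourier_int (- 2 * pi) (g n) \<in> borel_measurable borel"
      using gn_int by (auto dest: borel_measurable_integrable)
    have "(LINT x|lborel. F x * g n x) = (LINT x|lborel. f x * fourier_int (- 2 * pi) (g n) x)"
      unfolding F_def using integral_mult_fourier_int[OF f gn_int] by (simp add: mult.commute)
    also have "\<dots> = t n ^ DIM('a) *\<^sub>R (LINT u|lborel. f (a + t n *\<^sub>R u) * fourier_int (- 2 * pi) (g n) (a + t n *\<^sub>R u))"
      using t[of n] m by (subst integral_lborel_affine[of _ "t n" a]) auto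
    also have "\<dots> = (LINT u|lborel. t n ^ DIM('a) *\<^sub>R (f (a + t n *\<^sub>R u) * fourier_int (- 2 * pi) (g n) (a + t n *\<^sub>R u)))"
      by simp
    also have "\<dots> = (LINT u|lborel. gauss u *\<^sub>R f (a + t n *\<^sub>R u))"
      unfolding ghat using t[of n] by (simp add: scaleR_conv_of_real mult.commute)
    finally show ?thesis .
  qed
  have "(\<lambda>n. LINT x|lborel. F x * g n x) \<longlonglongrightarrow> (LINT x|lborel. F x * cis (2 * pi * (x \<bullet> a)))"
  proof (rule integral_dominated_convergence)
    show "integrable lborel (\<lambda>x. norm (F x))" using Fi by simp
    show "AE x in lborel. (\<lambda>n. F x * g n x) \<longlonglongrightarrow> F x * cis (2 * pi * (x \<bullet> a))"
    proof (intro AE_I2)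
      fix x :: 'a
      have "(\<lambda>n. F x * g n x) \<longlonglongrightarrow> F x * (exp (- pi * (norm (0 *\<^sub>R x))\<^sup>2) *\<^sub>R cis (2 * pi * (x \<bullet> a)))"
        unfolding g_def gauss_def by (intro tendsto_intros t0)
      then show "(\<lambda>n. F x * g n x) \<longlonglongrightarrow> F x * cis (2 * pi * (x \<bullet> a))" by simp
    qed
    show "AE x in lborel. norm (F x * g n x) \<le> norm (F x)" for n
      by (auto simp: g_def norm_mult gauss_def intro!: mult_left_le mult_left_le_one_le)
    show "(\<lambda>x. F x * cis (2 * pi * (x \<bullet> a))) \<in> borel_measurable lborel"
      "(\<lambda>x. F x * g n x) \<in> borel_measurable lborel" for n
      unfolding g_def by measurable
  qed
  moreover have "(\<lambda>n. LINT u|lborel. gauss u *\<^sub>R f (a + t n *\<^sub>R u)) \<longlonglongrightarrow> (LINT u|lborel. gauss (u::'a) *\<^sub>R f a)"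
  proof (rule integral_dominated_convergence)
    \<comment> \<open>Boundedness of \<open>f\<close> gives a dominating function independent of
      \<open>n\<close>.\<close>
    show "integrable lborel (\<lambda>u::'a. gauss u * B)" using gi by simp
    show "AE u in lborel. (\<lambda>n. gauss u *\<^sub>R f (a + t n *\<^sub>R u)) \<longlonglongrightarrow> gauss u *\<^sub>R f a"
    proof (intro AE_I2)
      fix u :: 'a
      have "(\<lambda>n. a + t n *\<^sub>R u) \<longlonglongrightarrow> a + 0 *\<^sub>R u"
        by (intro tendsto_intros t0)
      then have "(\<lambda>n. f (a + t n *\<^sub>R u)) \<longlonglongrightarrow> f a"
        using cont by (auto simp: continuous_on_eq_continuous_at isCont_def intro: isCont_tendsto_compose)
      then show "(\<lambda>n. gauss u *\<^sub>R f (a + t n *\<^sub>R u)) \<longlonglongrightarrow> gauss u *\<^sub>R f a"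
        by (intro tendsto_intros)
    qed
    show "AE u in lborel. norm (gauss u *\<^sub>R f (a + t n *\<^sub>R u)) \<le> gauss u * B" for n
      using bound by (auto simp: gauss_def)
  qed measurable
  ultimately have "(LINT x|lborel. F x * cis (2 * pi * (x \<bullet> a))) = (LINT u|lborel. gauss (u::'a) *\<^sub>R f a)"
    unfolding eq by (rule LIMSEQ_unique)
  then show ?thesis
    using gi by (simp add: fourier_int_def[of "2 * pi"] F_def gauss1)
qed

subsection \<open>Test functions\<close>

text \<open>Beyond radius \<open>R\<close> the function agrees with zero on an open set, and
  derivatives are unique.\<close>

lemma has_C1_derivative_compact_support:
  assumes "has_C1_derivative f D" "\<And>x. R < norm x \<Longrightarrow> f x = 0" "R < norm x"
  shows "D x h = 0"
proof -
  have "open {x. R < norm x}" by (intro open_Collect_less continuous_intros)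
  then have "((\<lambda>_. 0) has_derivative D x) (at x)"
    using has_derivative_transform_within_open[OF has_C1_derivativeD(1)[OF assms(1)], of "{x. R < norm x}" x "\<lambda>_. 0"] assms
    by auto
  then show ?thesis
    using has_derivative_unique[OF _ has_derivative_const] by metis
qed

lemma has_C1_derivative_mult:
  fixes f g :: "'a::euclidean_space \<Rightarrow> 'b::real_normed_algebra"
  assumes "has_C1_derivative f D" "has_C1_derivative g E"
  shows "has_C1_derivative (\<lambda>x. f x * g x) (\<lambda>x h. f x * E x h + D x h * g x)"
  unfolding has_C1_derivative_def
  by (intro conjI allI has_derivative_mult continuous_intros has_C1_derivativeD[OF assms(1)] has_C1_derivativeD[OF assms(2)])

lemma has_C1_derivative_cis:
  "has_C1_derivative (\<lambda>x. cis (s * (x \<bullet> y))) (\<lambda>x h. (s * (h \<bullet> y)) *\<^sub>R (\<i> * cis (s * (x \<bullet> y))))"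
  unfolding has_C1_derivative_def
  by (auto intro!: derivative_eq_intros continuous_intros)

lemma has_C1_derivative_bounded_linear:
  assumes "has_C1_derivative f D" and T: "bounded_linear T"
  shows "has_C1_derivative (\<lambda>x. T (f x)) (\<lambda>x h. T (D x h))"
  unfolding has_C1_derivative_def
  by (intro conjI allI bounded_linear.has_derivative[OF T] bounded_linear.continuous_on[OF T] has_C1_derivativeD[OF assms(1)])

lemma has_C1_derivative_scale:
  assumes "has_C1_derivative f D"
  shows "has_C1_derivative (\<lambda>x. f (t *\<^sub>R x)) (\<lambda>x h. t *\<^sub>R D (t *\<^sub>R x) h)"
  unfolding has_C1_derivative_def
proof (intro conjI allI)
  fix x
  have "((\<lambda>x. f (t *\<^sub>R x)) has_derivative (\<lambda>h. D (t *\<^sub>R x) (t *\<^sub>R h))) (at x)"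
    by (rule has_derivative_compose[OF _ has_C1_derivativeD(1)[OF assms]]) (auto intro!: derivative_eq_intros)
  then show "((\<lambda>x. f (t *\<^sub>R x)) has_derivative (\<lambda>h. t *\<^sub>R D (t *\<^sub>R x) h)) (at x)"
    by (simp add: linear_cmul[OF has_C1_derivativeD(4)[OF assms]])
next
  fix b
  show "continuous_on UNIV (\<lambda>x. t *\<^sub>R D (t *\<^sub>R x) b)"
    by (intro continuous_intros continuous_on_compose2[OF has_C1_derivativeD(2)[OF assms]]) auto
qed

section \<open>Testing divergences against compactly supported functions\<close>

lemma linear_euclidean_expansion:
  fixes L :: "'a::euclidean_space \<Rightarrow> 'b::real_vector"
  assumes "linear L"
  shows "L v = (\<Sum>b\<in>Basis. (v \<bullet> b) *\<^sub>R L b)"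
  by (subst euclidean_representation[of v, symmetric])
     (simp add: linear_sum[OF assms] linear_cmul[OF assms])

text \<open>The two integrands add up to the divergence of \<open>\<phi>\<close> times
  \<open>w\<close>, whose integral vanishes because \<open>\<phi>\<close> confines everything to a
  ball.\<close>

lemma integral_test_divergence:
  fixes \<phi> :: "'a::euclidean_space \<Rightarrow> complex" and w :: "'a \<Rightarrow> 'a"
  assumes \<phi>: "has_C1_derivative \<phi> P" and w: "has_C1_derivative w D"
    and supp: "\<And>x. R < norm x \<Longrightarrow> \<phi> x = 0"
  shows "(LINT x|lborel. \<phi> x * of_real (\<Sum>b\<in>Basis. D x b \<bullet> b)) = - (LINT x|lborel. P x (w x))" (is "integral\<^sup>L _ ?f = - integral\<^sup>L _ ?g")
proof -
  note supp' = has_C1_derivative_compact_support[OF \<phi> supp]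
  have Pw: "P x (w x) = (\<Sum>b\<in>Basis. P x b * of_real (w x \<bullet> b))" for x
    by (subst linear_euclidean_expansion[OF has_C1_derivativeD(4)[OF \<phi>]])
       (simp add: scaleR_conv_of_real mult.commute)
  have f: "integrable lborel ?f"
    by (rule integrable_compact_support[where R = R])
       (auto intro!: continuous_intros has_C1_derivativeD[OF \<phi>] has_C1_derivativeD[OF w] simp: supp)
  have g: "integrable lborel ?g"
    unfolding Pw
    by (rule integrable_compact_support[where R = R])
       (auto intro!: continuous_intros has_C1_derivativeD[OF \<phi>] has_C1_derivativeD[OF w] simp: supp')
  \<comment> \<open>By the product rule \<open>E b\<close> differentiates the
    \<open>b\<close>-component of \<open>\<phi>\<close> times \<open>w\<close>; summing
    \<open>E b x b\<close> over the basis yields its divergence.\<close>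
  define E where "E b x h = \<phi> x * of_real (D x h \<bullet> b) + P x h * of_real (w x \<bullet> b)" for b x h
  have bl: "bounded_linear (\<lambda>v::'a. complex_of_real (v \<bullet> b))" for b
    by (intro bounded_linear_compose[OF bounded_linear_of_real] bounded_linear_inner_left)
  have E: "has_C1_derivative (\<lambda>x. \<phi> x * of_real (w x \<bullet> b)) (E b)" for b
    using has_C1_derivative_mult[OF \<phi> has_C1_derivative_bounded_linear[OF w bl[of b]]]
    by (simp add: E_def[abs_def])
  have Eint: "integrable lborel (\<lambda>x. E b x b)" for b
    by (rule integrable_compact_support[where R = R])
       (use has_C1_derivativeD(2)[OF E] in \<open>auto simp: E_def supp supp'\<close>)
  have E0: "(LINT x|lborel. E b x b) = 0" for b
    by (rule integral_derivative_compact_support[OF E, where R = R]) (simp add: supp)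
  have "(LINT x|lborel. ?f x) + (LINT x|lborel. ?g x) = (LINT x|lborel. ?f x + ?g x)"
    using f g by simp
  also have "\<dots> = (LINT x|lborel. (\<Sum>b\<in>Basis. E b x b))"
    by (simp add: Pw E_def sum.distrib sum_distrib_left)
  also have "\<dots> = 0"
    using Eint E0 by simp
  finally show "(LINT x|lborel. ?f x) = - (LINT x|lborel. ?g x)"
    by (simp add: eq_neg_iff_add_eq_0)
qed

text \<open>The derivative of \<open>\<phi>\<close> times a character integrates to zero; the term
  in which the character is differentiated supplies the factor.\<close>

lemma fourier_int_derivative:
  fixes \<phi> :: "'a::euclidean_space \<Rightarrow> complex"
  assumes \<phi>: "has_C1_derivative \<phi> P" and supp: "\<And>x. R < norm x \<Longrightarrow> \<phi> x = 0"
  shows "fourier_int s (\<lambda>x. P x b) y = - (\<i> * of_real (s * (b \<bullet> y))) * fourier_int s \<phi> y"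
proof -
  note supp' = has_C1_derivative_compact_support[OF \<phi> supp]
  note C1 = has_C1_derivative_mult[OF \<phi> has_C1_derivative_cis[of s y]]
  let ?f = "\<lambda>x. \<phi> x * ((s * (b \<bullet> y)) *\<^sub>R (\<i> * cis (s * (x \<bullet> y))))" and ?g = "\<lambda>x. P x b * cis (s * (x \<bullet> y))"
  have f: "integrable lborel ?f" and g: "integrable lborel ?g"
    by (rule integrable_compact_support[where R = R],
        auto intro!: continuous_intros has_C1_derivativeD[OF \<phi>] simp: supp supp')+
  have "(LINT x|lborel. ?f x + ?g x) = 0"
    by (rule integral_derivative_compact_support[OF C1, where R = R]) (simp add: supp)
  then have "(LINT x|lborel. ?g x) = - (LINT x|lborel. ?f x)"
    using f g by (simp add: eq_neg_iff_add_eq_0 add.commute)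
  also have "(LINT x|lborel. ?f x) = (LINT x|lborel. (\<i> * of_real (s * (b \<bullet> y))) * (\<phi> x * cis (s * (x \<bullet> y))))"
    by (simp add: scaleR_conv_of_real mult_ac)
  also have "\<dots> = (\<i> * of_real (s * (b \<bullet> y))) * fourier_int s \<phi> y"
    unfolding fourier_int_def by (rule integral_mult_right_zero)
  finally show ?thesis by (simp add: fourier_int_def)
qed

text \<open>Squaring the positive part makes the function C1, which suffices for integration by
  parts. It is positive exactly on the open ball of radius \<open>\<bar>r\<bar>\<close> around
  \<open>a\<close>.\<close>

definition bump :: "real \<Rightarrow> 'a::euclidean_space \<Rightarrow> 'a \<Rightarrow> real" where
  "bump r a x = (max 0 (r\<^sup>2 - (norm (x - a))\<^sup>2))\<^sup>2"

lemma has_real_derivative_max_0_squared: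
  "((\<lambda>s::real. (max 0 s)\<^sup>2) has_real_derivative 2 * max 0 s) (at s)"
proof (cases s "0 :: real" rule: linorder_cases)
  case less
  have "((\<lambda>s::real. 0) has_real_derivative 0) (at s)" by simp
  then show ?thesis
    by (rule has_field_derivative_transform_within_open[of _ _ _ "{..<0}", THEN DERIV_cong]) (use less in auto)
next
  case equal
  \<comment> \<open>At the kink the difference quotient is \<open>h\<close> on the right and zero on
    the left.\<close>
  have "((\<lambda>h::real. ((max 0 h)\<^sup>2) / h) \<longlongrightarrow> 0) (at 0)"
  proof (rule Lim_null_comparison[OF always_eventually])
    show "\<forall>h::real. norm ((max 0 h)\<^sup>2 / h) \<le> \<bar>h\<bar>"
      by (auto simp: max_def power2_eq_square)
    show "((\<lambda>h::real. \<bar>h\<bar>) \<longlongrightarrow> 0) (at 0)"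
      using tendsto_rabs[OF tendsto_ident_at, of 0 UNIV] by simp
  qed
  then show ?thesis using equal by (simp add: DERIV_def)
next
  case greater
  have "((\<lambda>s::real. s\<^sup>2) has_real_derivative 2 * s) (at s)"
    by (auto intro!: derivative_eq_intros)
  then show ?thesis
    by (rule has_field_derivative_transform_within_open[of _ _ _ "{0<..}", THEN DERIV_cong]) (use greater in auto)
qed

lemma has_C1_derivative_bump:
  "has_C1_derivative (bump r a) (\<lambda>x h. - 4 * max 0 (r\<^sup>2 - (norm (x - a))\<^sup>2) * ((x - a) \<bullet> h))"
  unfolding has_C1_derivative_def
proof (intro conjI allI)
  fix x :: 'a
  have "((\<lambda>x. r\<^sup>2 - (norm (x - a))\<^sup>2) has_derivative (\<lambda>h. - 2 * ((x - a) \<bullet> h))) (at x)"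
    unfolding power2_norm_eq_inner by (auto intro!: derivative_eq_intros simp: inner_commute)
  from has_derivative_compose[OF this has_real_derivative_max_0_squared[unfolded has_field_derivative_def]]
  show "(bump r a has_derivative (\<lambda>h. - 4 * max 0 (r\<^sup>2 - (norm (x - a))\<^sup>2) * ((x - a) \<bullet> h))) (at x)"
    unfolding bump_def[abs_def] by (rule has_derivative_eq_rhs) (auto simp: fun_eq_iff)
qed (intro continuous_intros)

lemma bump_compact_support:
  assumes "norm a + \<bar>r\<bar> < norm x"
  shows "bump r a x = 0"
proof -
  have "\<bar>r\<bar> \<le> norm (x - a)"
    using assms norm_triangle_ineq2[of x a] by linarith
  then have "r\<^sup>2 \<le> (norm (x - a))\<^sup>2" by (metis abs_le_square_iff abs_norm_cancel)
  then show ?thesis by (simp add: bump_def)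
qed

text \<open>If \<open>d a\<close> were positive, so would be \<open>d\<close> on a ball around
  \<open>a\<close>. The bump of that ball then gives a nonnegative integrand with integral zero,
  which forces the ball to be a null set. Negative values are excluded by passing to
  \<open>- d\<close>.\<close>

lemma continuous_eq_0_if_bump_integrals_eq_0:
  fixes d :: "'a::euclidean_space \<Rightarrow> real"
  assumes cont: "continuous_on UNIV d" and zero: "\<And>r a. (LINT x|lborel. bump r a x * d x) = 0"
  shows "d a = 0"
proof -
  have *: "d a \<le> 0" if cont: "continuous_on UNIV d" and zero: "\<And>r a. (LINT x|lborel. bump r a x * d x) = 0" for d :: "'a \<Rightarrow> real"
  proof (rule ccontr)
    assume "\<not> d a \<le> 0"
    moreover have "open {x. 0 < d x}"
      by (intro open_Collect_less continuous_intros cont)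
    ultimately obtain r where r: "0 < r" "ball a r \<subseteq> {x. 0 < d x}"
      by (metis mem_Collect_eq not_le openE)
    have in_ball: "0 < bump r a x" if "x \<in> ball a r" for x
    proof -
      have "(norm (x - a))\<^sup>2 < r\<^sup>2"
        using that by (intro power_strict_mono) (auto simp: dist_norm norm_minus_commute)
      then show ?thesis by (simp add: bump_def)
    qed
    have out_ball: "bump r a x = 0" if "x \<notin> ball a r" for x
    proof -
      have "r\<^sup>2 \<le> (norm (x - a))\<^sup>2"
        using that r by (intro power_mono) (auto simp: dist_norm norm_minus_commute)
      then show ?thesis by (simp add: bump_def)
    qed
    have "integrable lborel (\<lambda>x. bump r a x * d x)"
      by (rule integrable_compact_support[where R = "norm a + \<bar>r\<bar>"])
         (auto intro!: continuous_intros cont has_C1_derivativeD(3)[OF has_C1_derivative_bump] simp: bump_compact_support)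
    moreover have "AE x in lborel. 0 \<le> bump r a x * d x"
    proof (intro AE_I2)
      fix x show "0 \<le> bump r a x * d x"
        using in_ball[of x] out_ball[of x] r(2) by (cases "x \<in> ball a r") (auto intro!: mult_nonneg_nonneg less_imp_le)
    qed
    ultimately have "AE x in lborel. bump r a x * d x = 0"
      using zero integral_nonneg_eq_0_iff_AE by blast
    then have "AE x in lborel. x \<notin> ball a r"
      by eventually_elim (use in_ball r(2) in fastforce)
    then have "ball a r \<in> null_sets lborel"
      by (subst AE_iff_null_sets) auto
    then have "negligible (ball a r)"
      by (simp add: negligible_iff_null_sets null_sets_completionI)
    then show False
      using open_not_negligible[of "ball a r"] r(1) by simp
  qed
  have "d a \<le> 0" by (rule *) (use assms in auto)
  moreover have "- d a \<le> 0" by (rule *[of "\<lambda>x. - d x"]) (use assms in \<open>auto intro: continuous_intros\<close>)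
  ultimately show ?thesis by simp
qed

subsection \<open>Divergence-free fields on the Fourier side\<close>

text \<open>Pairing \<open>w\<close> with \<open>\<xi>\<close> before transforming keeps all
  transforms scalar; at frequency \<open>\<xi>\<close> the result is the inner product of
  \<open>\<xi>\<close> with the transform of \<open>w\<close>. The bound and the integrable
  transforms are what Fourier inversion of each component asks for.\<close>

theorem divergence_eq_0_iff_fourier:
  fixes w :: "'a::euclidean_space \<Rightarrow> 'a"
  assumes C1: "has_C1_derivative w D" and int: "integrable lborel w"
    and bound: "\<And>x. norm (w x) \<le> B"
    and hat: "\<And>b. integrable lborel (fourier_int (- 2 * pi) (\<lambda>x. complex_of_real (w x \<bullet> b)))"
  shows "(\<forall>x. (\<Sum>b\<in>Basis. D x b \<bullet> b) = 0) \<longleftrightarrow>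
    (\<forall>\<xi>. fourier_int (- 2 * pi) (\<lambda>x. complex_of_real (w x \<bullet> \<xi>)) \<xi> = 0)"
proof (intro iffI allI)
  fix \<xi> :: 'a assume div: "\<forall>x. (\<Sum>b\<in>Basis. D x b \<bullet> b) = 0"
  define t where "t n = 1 / real (Suc n)" for n
  have t: "0 < t n" "t n \<le> 1" for n by (auto simp: t_def)
  have t0: "t \<longlonglongrightarrow> 0" unfolding t_def by (rule LIMSEQ_Suc[OF lim_const_over_n])
  define e where "e x = cis (- 2 * pi * (x \<bullet> \<xi>))" for x
  \<comment> \<open>\<open>P s\<close> differentiates the dilated bump and carries a factor
    \<open>s\<close>; \<open>Q s\<close> adds the term in which the character is differentiated. As
    \<open>s\<close> tends to zero only that term survives, since the bump takes the value one at
    the origin.\<close>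
  define P where "P s x h = s * (- 4 * max 0 (1 - (norm (s *\<^sub>R x))\<^sup>2) * ((s *\<^sub>R x) \<bullet> h))" for s and x h :: 'a
  define Q where "Q s x h = of_real (bump 1 0 (s *\<^sub>R x)) * ((- 2 * pi * (h \<bullet> \<xi>)) *\<^sub>R (\<i> * e x)) + of_real (P s x h) * e x" for s and x h :: 'a
  have Q: "has_C1_derivative (\<lambda>x. of_real (bump 1 0 (s *\<^sub>R x)) * e x) (Q s)" for s
    using has_C1_derivative_mult[OF has_C1_derivative_bounded_linear[OF
        has_C1_derivative_scale[OF has_C1_derivative_bump[of 1 "0::'a"], of s] bounded_linear_of_real]
      has_C1_derivative_cis[of "- 2 * pi" \<xi>]]
    unfolding Q_def[abs_def] P_def[abs_def] e_def by simp
  have Q0: "(LINT x|lborel. Q (t n) x (w x)) = 0" for n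
  proof -
    have "complex_of_real (bump 1 0 (t n *\<^sub>R x)) * e x = 0" if "1 / t n < norm x" for x
    proof -
      have "1 < norm (t n *\<^sub>R x)" using that t(1)[of n] by (simp add: field_simps)
      then show ?thesis using bump_compact_support[of "0::'a" 1 "t n *\<^sub>R x"] by simp
    qed
    from integral_test_divergence[OF Q C1 this] show ?thesis using div by simp
  qed
  have wm [measurable]: "w \<in> borel_measurable borel"
    using int by (auto dest: borel_measurable_integrable)
  have em [measurable]: "e \<in> borel_measurable borel"
    unfolding e_def by measurable
  have bm [measurable]: "bump 1 (0::'a) \<in> borel_measurable borel"
    by (intro borel_measurable_continuous_onI has_C1_derivativeD(3)[OF has_C1_derivative_bump])
  have "(\<lambda>n. LINT x|lborel. Q (t n) x (w x)) \<longlonglongrightarrow> (LINT x|lborel. (- 2 * pi * \<i>) * (complex_of_real (w x \<bullet> \<xi>) * e x))"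
  proof (rule integral_dominated_convergence)
    show "(\<lambda>x. (- 2 * pi * \<i>) * (complex_of_real (w x \<bullet> \<xi>) * e x)) \<in> borel_measurable lborel" by measurable
    show "(\<lambda>x. Q (t n) x (w x)) \<in> borel_measurable lborel" for n
      unfolding Q_def P_def by measurable
    \<comment> \<open>The part \<open>2 * pi * norm \<xi>\<close> bounds the differentiated
      character. The part 4 bounds \<open>P\<close>, because
      \<open>max 0 (1 - (norm y)\<^sup>2) * norm y\<close> and \<open>t n\<close> are at most
      one.\<close>
    show "integrable lborel (\<lambda>x. (2 * pi * norm \<xi> + 4) * norm (w x))"
      using int by simp
    show "AE x in lborel. (\<lambda>n. Q (t n) x (w x)) \<longlonglongrightarrow> (- 2 * pi * \<i>) * (complex_of_real (w x \<bullet> \<xi>) * e x)"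
    proof (intro AE_I2)
      fix x :: 'a
      have "(\<lambda>n. Q (t n) x (w x)) \<longlonglongrightarrow> Q 0 x (w x)"
        unfolding Q_def P_def bump_def by (intro tendsto_intros t0)
      then show "(\<lambda>n. Q (t n) x (w x)) \<longlonglongrightarrow> (- 2 * pi * \<i>) * (complex_of_real (w x \<bullet> \<xi>) * e x)"
        by (simp add: Q_def P_def bump_def scaleR_conv_of_real mult_ac)
    qed
    show "AE x in lborel. norm (Q (t n) x (w x)) \<le> (2 * pi * norm \<xi> + 4) * norm (w x)" for n
    proof (intro AE_I2)
      fix x :: 'a
      define y where "y = t n *\<^sub>R x"
      have e1: "norm (e x) = 1" by (simp add: e_def)
      have b: "0 \<le> bump 1 0 y" "bump 1 0 y \<le> 1"
        by (auto simp: bump_def intro!: power_le_one)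
      have "\<bar>- 2 * pi * (w x \<bullet> \<xi>)\<bar> \<le> 2 * pi * (norm (w x) * norm \<xi>)"
        using Cauchy_Schwarz_ineq2[of "w x" \<xi>] by (simp add: abs_mult)
      then have 1: "bump 1 0 y * \<bar>- 2 * pi * (w x \<bullet> \<xi>)\<bar> \<le> 1 * (2 * pi * (norm (w x) * norm \<xi>))"
        using b by (intro mult_mono) auto
      have "max 0 (1 - (norm y)\<^sup>2) * norm y \<le> 1"
      proof (cases "norm y \<le> 1")
        case True
        then have "max 0 (1 - (norm y)\<^sup>2) * norm y \<le> 1 * 1"
          by (intro mult_mono) auto
        then show ?thesis by simp
      next
        case False
        then have "1 \<le> (norm y)\<^sup>2" by (simp add: one_le_power)
        then show ?thesis by simp
      qed
      have "\<bar>P (t n) x (w x)\<bar> = t n * (4 * (max 0 (1 - (norm y)\<^sup>2) * \<bar>y \<bullet> w x\<bar>))"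
        using t(1)[of n] by (simp add: P_def y_def[symmetric] abs_mult del: inner_scaleR_left)
      also have "\<dots> \<le> 1 * (4 * (max 0 (1 - (norm y)\<^sup>2) * (norm y * norm (w x))))"
        using t[of n] Cauchy_Schwarz_ineq2[of y "w x"]
        by (intro mult_mono order_refl) auto
      also have "\<dots> \<le> 4 * norm (w x)"
        using mult_right_mono[OF \<open>max 0 (1 - (norm y)\<^sup>2) * norm y \<le> 1\<close>, of "norm (w x)"] by (simp add: mult.assoc)
      finally have 2: "\<bar>P (t n) x (w x)\<bar> \<le> 4 * norm (w x)" .
      have "norm (Q (t n) x (w x)) \<le> norm (of_real (bump 1 0 y) * ((- 2 * pi * (w x \<bullet> \<xi>)) *\<^sub>R (\<i> * e x)))
          + norm (of_real (P (t n) x (w x)) * e x)"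
        unfolding Q_def y_def by (rule norm_triangle_ineq)
      also have "\<dots> = bump 1 0 y * \<bar>- 2 * pi * (w x \<bullet> \<xi>)\<bar> + \<bar>P (t n) x (w x)\<bar>"
        using b(1) by (simp add: norm_mult e1)
      finally show "norm (Q (t n) x (w x)) \<le> (2 * pi * norm \<xi> + 4) * norm (w x)"
        using 1 2 by (simp add: algebra_simps)
    qed
  qed
  then have "(LINT x|lborel. (- 2 * pi * \<i>) * (complex_of_real (w x \<bullet> \<xi>) * e x)) = 0"
    unfolding Q0 by (simp add: LIMSEQ_const_iff)
  then show "fourier_int (- 2 * pi) (\<lambda>x. complex_of_real (w x \<bullet> \<xi>)) \<xi> = 0"
    by (simp add: fourier_int_def e_def)
next
  fix x assume fz: "\<forall>\<xi>. fourier_int (- 2 * pi) (\<lambda>x. complex_of_real (w x \<bullet> \<xi>)) \<xi> = 0"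
  define W where "W b = fourier_int (- 2 * pi) (\<lambda>x. complex_of_real (w x \<bullet> b))" for b
  have wi: "integrable lborel (\<lambda>x. complex_of_real (w x \<bullet> b))" for b
    using int by simp
  have Wi: "integrable lborel (W b)" for b unfolding W_def by (rule hat)
  have inv: "fourier_int (2 * pi) (W b) x = complex_of_real (w x \<bullet> b)" if "b \<in> Basis" for b x
    unfolding W_def
  proof (rule fourier_inversion[OF wi _ _ hat])
    show "continuous_on UNIV (\<lambda>x. complex_of_real (w x \<bullet> b))"
      by (intro continuous_intros has_C1_derivativeD(3)[OF C1])
    show "norm (complex_of_real (w x \<bullet> b)) \<le> B" for x
      using Basis_le_norm[OF that, of "w x"] bound[of x] by simp
  qed
  \<comment> \<open>The hypothesis involves a different scalar field for each frequency; expanding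
    \<open>\<xi>\<close> in the basis turns it into a linear relation among the fixed transforms
    \<open>W b\<close>.\<close>
  have W0: "(\<Sum>b\<in>Basis. of_real (b \<bullet> \<xi>) * W b \<xi>) = 0" for \<xi>
  proof -
    have i: "integrable lborel (\<lambda>x. of_real (b \<bullet> \<xi>) * (complex_of_real (w x \<bullet> b) * cis (- 2 * pi * (x \<bullet> \<xi>))))" for b
      by (intro integrable_mult_right integrable_mult_cis wi) measurable
    have "(\<Sum>b\<in>Basis. of_real (b \<bullet> \<xi>) * W b \<xi>) =
        (LINT x|lborel. (\<Sum>b\<in>Basis. of_real (b \<bullet> \<xi>) * (complex_of_real (w x \<bullet> b) * cis (- 2 * pi * (x \<bullet> \<xi>)))))"
      using i by (simp add: W_def fourier_int_def)
    also have "\<dots> = fourier_int (- 2 * pi) (\<lambda>x. complex_of_real (w x \<bullet> \<xi>)) \<xi>"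
      unfolding fourier_int_def
      by (subst euclidean_inner[of _ \<xi>])
         (simp add: sum_distrib_right sum_distrib_left inner_commute mult_ac)
    finally show ?thesis using fz by simp
  qed
  show "(\<Sum>b\<in>Basis. D x b \<bullet> b) = 0"
  proof (rule continuous_eq_0_if_bump_integrals_eq_0[where d = "\<lambda>x. \<Sum>b\<in>Basis. D x b \<bullet> b"])
    show "continuous_on UNIV (\<lambda>x. \<Sum>b\<in>Basis. D x b \<bullet> b)"
      by (intro continuous_intros has_C1_derivativeD(2)[OF C1])
    fix r :: real and a :: 'a
    define \<phi> where "\<phi> x = complex_of_real (bump r a x)" for x
    define P where "P x h = complex_of_real (- 4 * max 0 (r\<^sup>2 - (norm (x - a))\<^sup>2) * ((x - a) \<bullet> h))" for x h
    have \<phi>: "has_C1_derivative \<phi> P"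
      unfolding \<phi>_def[abs_def] P_def[abs_def]
      by (rule has_C1_derivative_bounded_linear[OF has_C1_derivative_bump bounded_linear_of_real])
    have supp: "\<phi> x = 0" if "norm a + \<bar>r\<bar> < norm x" for x
      using that by (simp add: \<phi>_def bump_compact_support)
    have Pi: "integrable lborel (\<lambda>x. P x b)" for b
      by (rule integrable_compact_support[OF has_C1_derivativeD(2)[OF \<phi>] has_C1_derivative_compact_support[OF \<phi> supp]])
    \<comment> \<open>Inversion writes each component of \<open>w\<close> as the inverse transform
      of \<open>W b\<close>; the multiplication formula then moves that transform onto the
      derivatives of \<open>\<phi>\<close>.\<close>
    have "P x (w x) = (\<Sum>b\<in>Basis. P x b * fourier_int (2 * pi) (W b) x)" for x
      by (subst linear_euclidean_expansion[OF has_C1_derivativeD(4)[OF \<phi>]])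
         (intro sum.cong refl, simp only: inv scaleR_conv_of_real, rule mult.commute)
    then have "(LINT x|lborel. P x (w x)) = (LINT x|lborel. (\<Sum>b\<in>Basis. P x b * fourier_int (2 * pi) (W b) x))"
      by simp
    also have "\<dots> = (\<Sum>b\<in>Basis. LINT \<xi>|lborel. W b \<xi> * fourier_int (2 * pi) (\<lambda>x. P x b) \<xi>)"
      using integrable_mult_fourier_int[OF Pi Wi, of _ "2 * pi"]
      by (simp add: integral_mult_fourier_int[OF Pi Wi, of _ "2 * pi"])
    also have "\<dots> = (LINT \<xi>|lborel. (\<Sum>b\<in>Basis. W b \<xi> * fourier_int (2 * pi) (\<lambda>x. P x b) \<xi>))"
      using integrable_mult_fourier_int[OF Wi Pi, of _ "2 * pi"] by simp
    \<comment> \<open>Transforming the derivative in direction \<open>b\<close> produces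
      \<open>b \<bullet> \<xi>\<close>, so the remaining sum is the one that vanishes by
      \<open>W0\<close>.\<close>
    also have "\<dots> = (LINT \<xi>|lborel. (- \<i> * of_real (2 * pi) * fourier_int (2 * pi) \<phi> \<xi>) * (\<Sum>b\<in>Basis. of_real (b \<bullet> \<xi>) * W b \<xi>))"
      by (simp add: fourier_int_derivative[OF \<phi> supp] sum_distrib_left sum_negf mult_ac)
    also have "\<dots> = 0" unfolding W0 by simp
    finally have "(LINT x|lborel. \<phi> x * of_real (\<Sum>b\<in>Basis. D x b \<bullet> b)) = 0"
      using integral_test_divergence[OF \<phi> C1 supp] by simp
    then have "complex_of_real (LINT x|lborel. bump r a x * (\<Sum>b\<in>Basis. D x b \<bullet> b)) = 0"
      unfolding \<phi>_def of_real_mult[symmetric] integral_complex_of_real .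
    then show "(LINT x|lborel. bump r a x * (\<Sum>b\<in>Basis. D x b \<bullet> b)) = 0" by simp
  qed
qed

subsection \<open>Matrix-valued kernels\<close>

lemma matrix_eq_sum_axis:
  fixes A :: "real^'d^'d"
  shows "A = (\<Sum>i\<in>UNIV. \<Sum>j\<in>UNIV. A $ i $ j *\<^sub>R axis i (axis j 1))"
proof -
  have "axis i (axis j (1::real)) $ a $ b = (if i = a then if j = b then 1 else 0 else 0)" for i j a b :: 'd
    by (simp add: axis_def)
  then have "A $ i $ j * axis i (axis j 1) $ a $ b = (if i = a then if j = b then A $ a $ b else 0 else 0)" for i j a b
    by simp
  moreover have "(\<Sum>j\<in>UNIV. if i = a then if j = b then A $ a $ b else 0 else 0) = (if i = a then A $ a $ b else 0)" for i a b
    by simp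
  ultimately show ?thesis
    by (simp add: vec_eq_iff)
qed

lemma linear_matrix_expansion:
  fixes L :: "real^'d^'d \<Rightarrow> real"
  assumes "linear L"
  shows "L A = (\<Sum>i\<in>UNIV. \<Sum>j\<in>UNIV. A $ i $ j * L (axis i (axis j 1)))"
  by (subst matrix_eq_sum_axis[of A]) (simp add: linear_sum[OF assms] linear_cmul[OF assms])

lemma norm_matrix_le_sum:
  fixes A :: "real^'d^'d"
  shows "norm A \<le> (\<Sum>i\<in>UNIV. \<Sum>j\<in>UNIV. \<bar>A $ i $ j\<bar>)"
proof -
  have "norm A \<le> (\<Sum>i\<in>UNIV. norm (A $ i))"
    unfolding norm_vec_def by (rule L2_set_le_sum) auto
  also have "\<dots> \<le> (\<Sum>i\<in>UNIV. \<Sum>j\<in>UNIV. \<bar>A $ i $ j\<bar>)"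
    by (intro sum_mono norm_le_l1_cart)
  finally show ?thesis .
qed

lemma inner_axis_matrix_axis: "axis i (c::real) \<bullet> ((A::real^'d^'d) *v axis j c') = c * A $ i $ j * c'"
  by (simp add: inner_axis' matrix_vector_mul_component inner_axis)

text \<open>Fourier inversion asks for a bounded function. Positive definiteness supplies it: the
  diagonal of \<open>k 0\<close> controls all entries of \<open>k x\<close>, uniformly in
  \<open>x\<close>.\<close>

lemma TRI_kernel_bounded:
  assumes "TRI_kernel k"
  obtains B where "\<And>x. norm (k x) \<le> B"
proof
  fix x
  have entry: "\<bar>k x $ i $ j\<bar> \<le> (k 0 $ i $ i + k 0 $ j $ j) / 2" for i j
  proof -
    \<comment> \<open>positive definiteness for the points \<open>x, 0\<close> and the vectors \<open>e\<^sub>i, c e\<^sub>j\<close>\<close>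
    have "0 \<le> k 0 $ i $ i + 2 * c * k x $ i $ j + c\<^sup>2 * k 0 $ j $ j" for c
    proof -
      define y where "y a = (if a = 0 then x else 0)" for a :: nat
      define \<beta> where "\<beta> a = (if a = 0 then axis i 1 else axis j c)" for a :: nat
      have "0 \<le> (\<Sum>a<2. \<Sum>b<2. \<beta> a \<bullet> (k (y a - y b) *v \<beta> b))"
        using assms unfolding TRI_kernel_def by blast
      \<comment> \<open>This symmetry makes the two mixed terms of the quadratic form equal.\<close>
      moreover have "k (- x) = transpose (k x)"
        using assms unfolding TRI_kernel_def by blast
      ultimately show ?thesis
        by (simp add: numeral_2_eq_2 y_def \<beta>_def inner_axis_matrix_axis transpose_def power2_eq_square algebra_simps)
    qed
    \<comment> \<open>The two signs of \<open>c\<close> bound the entry from below and from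
      above.\<close>
    from this[of 1] this[of "-1"] show ?thesis by simp
  qed
  show "norm (k x) \<le> (\<Sum>i\<in>UNIV. \<Sum>j\<in>UNIV. (k 0 $ i $ i + k 0 $ j $ j) / 2)"
    by (rule order_trans[OF norm_matrix_le_sum]) (intro sum_mono entry)
qed

lemma integrable_matrix_entry:
  assumes "integrable M (f :: _ \<Rightarrow> 'b::euclidean_space^'d^'d)"
  shows "integrable M (\<lambda>x. f x $ i $ j)"
  using integrable_bounded_linear[OF bounded_linear_compose[OF bounded_linear_vec_nth bounded_linear_vec_nth] assms] .

text \<open>\<open>L\<close> acts on real matrices while \<open>fourier_matrix k\<close> is complex,
  so \<open>L\<close> is carried across by its values on the matrix units
  \<open>axis i (axis j 1)\<close>.\<close>

lemma fourier_int_linear_functional: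
  fixes k :: "real^'d \<Rightarrow> real^'d^'d"
  assumes "integrable lborel k" and L: "linear L"
  shows "fourier_int (- 2 * pi) (\<lambda>x. complex_of_real (L (k x))) \<xi> =
    (\<Sum>i\<in>UNIV. \<Sum>j\<in>UNIV. of_real (L (axis i (axis j 1))) * fourier_matrix k \<xi> $ i $ j)"
proof -
  have ci: "integrable lborel (\<lambda>x. of_real (L (axis i (axis j 1))) * (complex_of_real (k x $ i $ j) * cis (- 2 * pi * (x \<bullet> \<xi>))))" for i j
    by (intro integrable_mult_right integrable_mult_cis integrable_of_real integrable_matrix_entry assms) measurable
  have entry: "fourier_matrix k \<xi> $ i $ j = (LINT x|lborel. complex_of_real (k x $ i $ j) * cis (- 2 * pi * (x \<bullet> \<xi>)))" for i j
    by (simp add: fourier_matrix_def cis_conv_exp mult_ac)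
  have "complex_of_real (L (k x)) * cis (- 2 * pi * (x \<bullet> \<xi>)) =
      (\<Sum>i\<in>UNIV. \<Sum>j\<in>UNIV. of_real (L (axis i (axis j 1))) * (complex_of_real (k x $ i $ j) * cis (- 2 * pi * (x \<bullet> \<xi>))))" for x
    by (subst linear_matrix_expansion[OF L]) (simp add: sum_distrib_left sum_distrib_right mult_ac)
  then show ?thesis
    unfolding fourier_int_def entry using ci by simp
qed

lemma sum_Basis_vec:
  fixes f :: "real^'d \<Rightarrow> 'b::comm_monoid_add"
  shows "(\<Sum>b\<in>Basis. f b) = (\<Sum>i\<in>UNIV. f (axis i 1))"
proof -
  have "inj (\<lambda>i::'d. axis i (1::real))" by (simp add: inj_on_def axis_eq_axis)
  moreover have "Basis = range (\<lambda>i::'d. axis i (1::real))" by (auto simp: Basis_vec_def)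
  ultimately show ?thesis using sum.reindex[of "\<lambda>i::'d. axis i (1::real)" UNIV f] by (simp add: o_def)
qed

lemma proj_par_mult_vec: "proj_par x *v a = ((x \<bullet> a) / (norm x)\<^sup>2) *\<^sub>R x"
  by (simp add: vec_eq_iff proj_par_def matrix_vector_mult_def inner_vec_def sum_distrib_left sum_divide_distrib mult_ac)

text \<open>Splitting off \<open>q\<close> times the identity leaves a multiple of \<open>x\<close>.
  The formula also covers \<open>x = 0\<close>, where division by zero makes \<open>proj_par\<close>
  vanish.\<close>

lemma radial_matrix_mult_vec:
  "(p *\<^sub>R proj_par x + q *\<^sub>R proj_perp x) *v a = ((p - q) * (x \<bullet> a) / (norm x)\<^sup>2) *\<^sub>R x + q *\<^sub>R a"
  by (simp add: proj_perp_def matrix_vector_mult_add_rdistrib matrix_vector_mult_diff_rdistrib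
      scaleR_matrix_vector_assoc[symmetric] proj_par_mult_vec algebra_simps diff_divide_distrib)

text \<open>A general linear \<open>T\<close> lets one statement handle both the divergence, with
  \<open>T\<close> multiplying by a vector, and every single curl component.\<close>

lemma divergence_linear_image_eq_0_iff:
  fixes k M :: "real^'d \<Rightarrow> real^'d^'d" and T :: "real^'d^'d \<Rightarrow> real^'d"
  assumes C1: "has_C1_derivative k D" and L1: "integrable lborel k" and TRI: "TRI_kernel k"
    and L1_hat: "integrable lborel (fourier_matrix k)"
    and M: "\<And>\<xi>. \<xi> \<noteq> 0 \<Longrightarrow> fourier_matrix k \<xi> = map_matrix complex_of_real (M \<xi>)"
    and T: "linear T"
  shows "(\<forall>x. (\<Sum>m\<in>UNIV. T (D x (axis m 1)) $ m) = 0) \<longleftrightarrow> (\<forall>\<xi>. \<xi> \<noteq> 0 \<longrightarrow> T (M \<xi>) \<bullet> \<xi> = 0)"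
proof -
  have bl: "bounded_linear T" using T by (simp add: linear_conv_bounded_linear)
  have lin: "linear (\<lambda>A. T A \<bullet> b)" for b
    using linear_compose[OF T, of "\<lambda>v. v \<bullet> b"] bounded_linear.linear[OF bounded_linear_inner_left[of b]]
    by (simp add: o_def)
  note fourier = fourier_int_linear_functional[OF L1 lin]
  obtain B where B: "\<And>x. norm (k x) \<le> B" using TRI_kernel_bounded[OF TRI] by blast
  obtain K where K: "0 \<le> K" "\<And>A. norm (T A) \<le> norm A * K"
    using bounded_linear.nonneg_bounded[OF bl] by blast
  have "(\<forall>x. (\<Sum>b\<in>Basis. T (D x b) \<bullet> b) = 0) \<longleftrightarrow>
      (\<forall>\<xi>. fourier_int (- 2 * pi) (\<lambda>x. complex_of_real (T (k x) \<bullet> \<xi>)) \<xi> = 0)"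
  proof (rule divergence_eq_0_iff_fourier)
    show "has_C1_derivative (\<lambda>x. T (k x)) (\<lambda>x h. T (D x h))"
      by (rule has_C1_derivative_bounded_linear[OF C1 bl])
    show "integrable lborel (\<lambda>x. T (k x))"
      by (rule integrable_bounded_linear[OF bl L1])
    show "norm (T (k x)) \<le> B * K" for x
      using K(2)[of "k x"] mult_right_mono[OF B K(1), of x] by linarith
    show "integrable lborel (fourier_int (- 2 * pi) (\<lambda>x. complex_of_real (T (k x) \<bullet> b)))" for b
      unfolding fourier[abs_def]
      by (intro Bochner_Integration.integrable_sum integrable_mult_right integrable_matrix_entry L1_hat)
  qed
  \<comment> \<open>At frequency zero, where \<open>M\<close> is unconstrained, both sides hold
    trivially because the field is paired with the zero vector.\<close>
  moreover have "fourier_int (- 2 * pi) (\<lambda>x. complex_of_real (T (k x) \<bullet> \<xi>)) \<xi> = 0 \<longleftrightarrow> (\<xi> \<noteq> 0 \<longrightarrow> T (M \<xi>) \<bullet> \<xi> = 0)" for \<xi>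
  proof (cases "\<xi> = 0")
    case False
    have "fourier_int (- 2 * pi) (\<lambda>x. complex_of_real (T (k x) \<bullet> \<xi>)) \<xi> = complex_of_real (T (M \<xi>) \<bullet> \<xi>)"
      unfolding fourier M[OF False]
      by (subst linear_matrix_expansion[OF lin]) (simp add: map_matrix_def mult.commute)
    then show ?thesis using False by simp
  qed (simp add: fourier_int_def)
  ultimately show ?thesis
    by (simp add: sum_Basis_vec inner_axis)
qed

section \<open>Partial derivatives and the two equivalences\<close>

lemma partial_deriv_eq_derivative:
  assumes "\<And>x. (v has_derivative V x) (at x)"
  shows "partial_deriv i (\<lambda>y. v y $ j) x = V x (axis i 1) $ j"
proof -
  have "((\<lambda>t. v (x + t *\<^sub>R axis i 1)) has_derivative (\<lambda>t. V (x + 0 *\<^sub>R axis i 1) (t *\<^sub>R axis i 1))) (at 0)"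
    by (rule has_derivative_compose[OF _ assms]) (auto intro!: derivative_eq_intros)
  then have "((\<lambda>t. v (x + t *\<^sub>R axis i 1) $ j) has_derivative (\<lambda>t. V x (t *\<^sub>R axis i 1) $ j)) (at 0)"
    using bounded_linear.has_derivative[OF bounded_linear_vec_nth] by auto
  then have "((\<lambda>t. v (x + t *\<^sub>R axis i 1) $ j) has_real_derivative V x (axis i 1) $ j) (at 0)"
    by (simp add: has_field_derivative_def linear_cmul[OF has_derivative_linear[OF assms]] mult_commute_abs)
  then show ?thesis unfolding partial_deriv_def by (rule DERIV_imp_deriv)
qed

theorem theorem3p19:
  fixes k :: "real^'d \<Rightarrow> real^'d^'d"
    and h_par h_perp :: "real \<Rightarrow> real"
  assumes dim: "CARD('d) \<ge> 2"
    and C1: "C1_on_UNIV k"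
    and L1: "integrable lborel k"
    and TRI: "TRI_kernel k"
    and L1_hat: "integrable lborel (fourier_matrix k)"
    and h: "\<And>\<xi>. \<xi> \<noteq> 0 \<Longrightarrow> fourier_matrix k \<xi> =
      map_matrix complex_of_real
        (h_par (norm \<xi>) *\<^sub>R proj_par \<xi> + h_perp (norm \<xi>) *\<^sub>R proj_perp \<xi>)"
  shows "((\<forall>\<alpha>. divergence_free (\<lambda>x. k x *v \<alpha>)) \<longleftrightarrow> (\<forall>r>0. h_par r = 0)) \<and>
         ((\<forall>\<alpha>. curl_free (\<lambda>x. k x *v \<alpha>)) \<longleftrightarrow> (\<forall>r>0. h_perp r = 0))"
proof -
  obtain k' :: "real^'d \<Rightarrow> (real^'d) \<Rightarrow>\<^sub>L (real^'d^'d)"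
    where k': "\<And>x. (k has_derivative blinfun_apply (k' x)) (at x)" "continuous_on UNIV k'"
    using C1 unfolding C1_on_UNIV_def by blast
  define D where "D x = blinfun_apply (k' x)" for x
  have D: "has_C1_derivative k D"
    unfolding has_C1_derivative_def D_def using k' by (auto intro!: continuous_intros)
  have mv: "linear (\<lambda>A::real^'d^'d. A *v \<alpha>)" for \<alpha>
    by (rule linearI) (simp_all add: matrix_vector_mult_add_rdistrib scaleR_matrix_vector_assoc)
  have kv: "((\<lambda>x. k x *v \<alpha>) has_derivative (\<lambda>h. D x h *v \<alpha>)) (at x)" for x \<alpha>
    by (rule bounded_linear.has_derivative[OF _ has_C1_derivativeD(1)[OF D]])
       (use mv in \<open>simp add: linear_conv_bounded_linear\<close>)
  define M where "M \<xi> = h_par (norm \<xi>) *\<^sub>R proj_par \<xi> + h_perp (norm \<xi>) *\<^sub>R proj_perp \<xi>" for \<xi> :: "real^'d"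
  have key: "(\<forall>x. (\<Sum>m\<in>UNIV. T (D x (axis m 1)) $ m) = 0) \<longleftrightarrow> (\<forall>\<xi>. \<xi> \<noteq> 0 \<longrightarrow> T (M \<xi>) \<bullet> \<xi> = 0)"
    if "linear T" for T :: "real^'d^'d \<Rightarrow> real^'d"
    by (rule divergence_linear_image_eq_0_iff[OF D L1 TRI L1_hat _ that]) (simp add: h M_def)
  have "divergence_free (\<lambda>x. k x *v \<alpha>) \<longleftrightarrow> (\<forall>\<xi>. \<xi> \<noteq> 0 \<longrightarrow> h_par (norm \<xi>) * (\<xi> \<bullet> \<alpha>) = 0)" for \<alpha>
  proof -
    \<comment> \<open>Pairing with \<open>\<xi>\<close> annihilates the perpendicular part.\<close>
    have "(M \<xi> *v \<alpha>) \<bullet> \<xi> = h_par (norm \<xi>) * (\<xi> \<bullet> \<alpha>)" if "\<xi> \<noteq> 0" for \<xi>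
      unfolding M_def radial_matrix_mult_vec using that
      by (simp add: inner_simps dot_square_norm inner_commute[of \<alpha>]) (simp add: algebra_simps)
    then show ?thesis
      using key[OF mv[of \<alpha>]]
      by (simp add: divergence_free_def divergence_def partial_deriv_eq_derivative[OF kv])
  qed
  \<comment> \<open>The choice of \<open>\<alpha>\<close> equal to \<open>\<xi>\<close> makes the
    second factor nonzero.\<close>
  then have div: "(\<forall>\<alpha>. divergence_free (\<lambda>x. k x *v \<alpha>)) \<longleftrightarrow> (\<forall>\<xi>::real^'d. \<xi> \<noteq> 0 \<longrightarrow> h_par (norm \<xi>) = 0)"
    by (metis inner_eq_zero_iff mult_eq_0_iff)
  have curl: "curl_free (\<lambda>x. k x *v \<alpha>) \<longleftrightarrow>
      (\<forall>i j \<xi>. \<xi> \<noteq> 0 \<longrightarrow> h_perp (norm \<xi>) * (\<xi> $ i * \<alpha> $ j - \<xi> $ j * \<alpha> $ i) = 0)" for \<alpha>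
  proof -
    \<comment> \<open>chosen so that the \<open>(i, j)\<close> entry of the curl of \<open>k \<alpha>\<close> is the divergence of \<open>T i j \<circ> k\<close>\<close>
    define T where "T i j A = (A *v \<alpha>) $ j *\<^sub>R axis i 1 - (A *v \<alpha>) $ i *\<^sub>R (axis j 1 :: real^'d)" for i j and A :: "real^'d^'d"
    have T: "linear (T i j)" for i j
      by (rule linearI) (simp_all add: T_def linear_add[OF mv] linear_cmul[OF mv] algebra_simps)
    have sum: "(\<Sum>m\<in>UNIV. T i j (D x (axis m 1)) $ m) = curl (\<lambda>x. k x *v \<alpha>) x $ i $ j" for i j x
    proof -
      have "T i j (D x (axis m 1)) $ m = (if m = i then (D x (axis m 1) *v \<alpha>) $ j else 0) -
          (if m = j then (D x (axis m 1) *v \<alpha>) $ i else 0)" for m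
        by (simp add: T_def axis_eq_axis) (simp add: axis_def)
      then show ?thesis
        by (simp add: curl_def partial_deriv_eq_derivative[OF kv] sum_subtractf)
    qed
    \<comment> \<open>The component of \<open>M \<xi> *v \<alpha>\<close> along \<open>\<xi>\<close>
      cancels by antisymmetry in \<open>i\<close> and \<open>j\<close>, leaving only
      \<open>h_perp (norm \<xi>)\<close> times \<open>\<alpha>\<close>.\<close>
    have "T i j (M \<xi>) \<bullet> \<xi> = h_perp (norm \<xi>) * (\<xi> $ i * \<alpha> $ j - \<xi> $ j * \<alpha> $ i)" for i j \<xi>
      unfolding T_def M_def radial_matrix_mult_vec by (simp add: inner_diff_left inner_axis' algebra_simps)
    then have "(\<forall>x. curl (\<lambda>x. k x *v \<alpha>) x $ i $ j = 0) \<longleftrightarrow>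
        (\<forall>\<xi>. \<xi> \<noteq> 0 \<longrightarrow> h_perp (norm \<xi>) * (\<xi> $ i * \<alpha> $ j - \<xi> $ j * \<alpha> $ i) = 0)" for i j
      using key[OF T[of i j]] unfolding sum by simp
    then show ?thesis
      unfolding curl_free_def vec_eq_iff zero_index by blast
  qed
  \<comment> \<open>Dimension at least two provides a direction perpendicular to the frequency,
    which the curl needs in order to detect \<open>h_perp\<close>.\<close>
  obtain i j :: 'd where "i \<noteq> j"
    using dim card_le_Suc0_iff_eq[of "UNIV :: 'd set"] by auto
  then have unit: "axis j (1::real) $ j = 1" "axis i (1::real) $ i = 1" "axis j (1::real) $ i = 0"
    "axis i (1::real) $ j = 0"
    by (auto simp: axis_def)
  \<comment> \<open>Multiples of one axis vector realise every positive radius, so conditions on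
    frequencies become conditions on \<open>r\<close>.\<close>
  have axis: "r *\<^sub>R axis i 1 \<noteq> (0 :: real^'d)" "norm (r *\<^sub>R axis i 1 :: real^'d) = r" if "0 < r" for r
    using that by (auto simp: axis_eq_0_iff)
  show ?thesis
  proof (intro conjI iffI)
    assume "\<forall>\<alpha>. divergence_free (\<lambda>x. k x *v \<alpha>)"
    then show "\<forall>r>0. h_par r = 0" unfolding div using axis by metis
  next
    assume "\<forall>r>0. h_par r = 0"
    then show "\<forall>\<alpha>. divergence_free (\<lambda>x. k x *v \<alpha>)" unfolding div by simp
  next
    assume "\<forall>\<alpha>. curl_free (\<lambda>x. k x *v \<alpha>)"
    then have "curl_free (\<lambda>x. k x *v axis j 1)" by blast
    then have *: "h_perp (norm \<xi>) * (\<xi> $ i * axis j 1 $ j - \<xi> $ j * axis j 1 $ i) = 0" if "\<xi> \<noteq> 0" for \<xi>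
      unfolding curl using that by blast
    show "\<forall>r>0. h_perp r = 0"
    proof (intro allI impI)
      fix r :: real assume "0 < r"
      \<comment> \<open>For the frequency \<open>r\<close> times the \<open>i\<close>-th axis vector
        and the \<open>j\<close>-th axis vector as \<open>\<alpha>\<close>, the antisymmetric factor
        equals \<open>r\<close>.\<close>
      then show "h_perp r = 0" using *[OF axis(1)[of r]] axis(2)[of r] by (simp add: unit)
    qed
  next
    assume "\<forall>r>0. h_perp r = 0"
    then show "\<forall>\<alpha>. curl_free (\<lambda>x. k x *v \<alpha>)" unfolding curl by simp
  qed
qed

end
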